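(* Let $H_1,H_2$ be real Hilbert spaces, $C:H_1\to H_2$ a bounded linear mapping with adjoint $C^T:H_2\to H_1$, and $\mathcal{M}:H_2\rightrightarrows H_2$ a maximal monotone operator. Let $\lambda>0$ and $y\in H_1$ be given. Choose $\mu>0$ such that $\lambda\mu\in(0,2/\|C\|^2)$, and let $(\alpha_k)\subset(0,1)$ satisfy $\sum_{k=1}^\infty\alpha_k(1-\alpha_k)=\infty$. Let $\mathcal{Q}:H_2\to H_2$ be defined by $$\mathcal{Q}(u):=\big(I-J_{\frac1\mu\mathcal{M}}\big)\Big(Cy+\big(I-\lambda\mu CC^T\big)u\Big),$$ and construct the sequence $(u_k)$ as follows (Algorithm 2): $$u_0\in H_2,\qquad u_{k+1}=(1-\alpha_k)u_k+\alpha_k\mathcal{Q}(u_k),\qquad k=0,1,2,\ldots$$ Then the sequence $(u_k)$ converges weakly to a fixed point $u$ of $\mathcal{Q}$, and $J_{\lambda C^T\mathcal{M}C}\,y=y-\lambda\mu C^Tu$. Furthermore, if $\inf\alpha_k>0$, then the sequence $(x_k)$ defined by $x_k:=y-\lambda\mu C^Tu_k$ converges strongly to $J_{\lambda C^T\mathcal{M}C}\,y$.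
   Context: The composite $C^T\mathcal{M}C:H_1\rightrightarrows H_1$ is $C^T\mathcal{M}C(x)=\{C^Tu^*: u^*\in\mathcal{M}(Cx)\}$. The resolvent of an operator $\mathcal{A}$ is $J_{\mathcal{A}}=(I+\mathcal{A})^{-1}$, so $x=J_{\lambda C^T\mathcal{M}C}\,y$ means that $x\in H_1$ satisfies $y\in x+\lambda C^T\mathcal{M}Cx$.
   Formalization: The formal theorem also assumes that J_{λC^T M C} y exists, i.e. some x satisfies y ∈ x + λC^T M C x; without this Q may have no fixed point and the claim fails, and any fixed point of Q implies it. *)

theory Defs
  imports "HOL-Analysis.Analysis"
begin

text \<open>
  A set-valued operator on \<open>'a\<close> is a function of type \<open>'a \<Rightarrow> 'a set\<close>, with \<open>A x = {}\<close> for
  \<open>x\<close> outside its domain. A real Hilbert space is a type of sort \<open>{real_inner, complete_space}\<close>.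
\<close>

definition monotone_operator :: "('a::real_inner \<Rightarrow> 'a set) \<Rightarrow> bool" where
  "monotone_operator A \<longleftrightarrow>
     (\<forall>x y. \<forall>u\<in>A x. \<forall>v\<in>A y. 0 \<le> (x - y) \<bullet> (u - v))"

definition maximal_monotone :: "('a::real_inner \<Rightarrow> 'a set) \<Rightarrow> bool" where
  "maximal_monotone A \<longleftrightarrow> monotone_operator A \<and>
     (\<forall>B. monotone_operator B \<and> (\<forall>x. A x \<subseteq> B x) \<longrightarrow> B = A)"

definition scale_operator :: "real \<Rightarrow> ('a \<Rightarrow> 'a::real_vector set) \<Rightarrow> 'a \<Rightarrow> 'a set" where
  "scale_operator c A x = (\<lambda>w. c *\<^sub>R w) ` A x"

definition composite_operator ::
    "('a::real_inner \<Rightarrow> 'b::real_inner) \<Rightarrow> ('b \<Rightarrow> 'b set) \<Rightarrow> 'a \<Rightarrow> 'a set" where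
  "composite_operator C M x = adjoint C ` M (C x)"

text \<open>
  The resolvent \<open>(I + A)\<inverse>\<close> is itself set-valued: \<open>x \<in> resolvent A y\<close> iff \<open>y \<in> x + A x\<close>.
  It has at most one value at each point if \<open>A\<close> is monotone, and exactly one if \<open>A\<close> is maximal
  monotone on a Hilbert space; \<open>resolvent_point\<close> is that value, and is meaningful only where the
  resolvent is a singleton.
\<close>

definition resolvent :: "('a::real_vector \<Rightarrow> 'a set) \<Rightarrow> 'a \<Rightarrow> 'a set" where
  "resolvent A y = {x. y \<in> (\<lambda>w. x + w) ` A x}"

definition resolvent_point :: "('a::real_vector \<Rightarrow> 'a set) \<Rightarrow> 'a \<Rightarrow> 'a" where
  "resolvent_point A y = the_elem (resolvent A y)"

definition fixed_point_map ::
    "('a::real_inner \<Rightarrow> 'b::real_inner) \<Rightarrow> ('b \<Rightarrow> 'b set) \<Rightarrow> real \<Rightarrow> real \<Rightarrow> 'a \<Rightarrow> 'b \<Rightarrow> 'b" where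
  "fixed_point_map C M l m y u =
     (let z = C y + (u - (l * m) *\<^sub>R C (adjoint C u))
      in z - resolvent_point (scale_operator (1 / m) M) z)"

definition weakly_converges :: "(nat \<Rightarrow> 'a::real_normed_vector) \<Rightarrow> 'a \<Rightarrow> bool" where
  "weakly_converges s l \<longleftrightarrow>
     (\<forall>f::'a \<Rightarrow> real. bounded_linear f \<longrightarrow> (\<lambda>k. f (s k)) \<longlonglongrightarrow> f l)"

end

theory Submission
  imports Defs
begin

text \<open>
  Write \<open>s = l * m\<close>, let \<open>C\<^sup>T\<close> be the adjoint, \<open>J\<close> the resolvent of \<open>M\<close> scaled by \<open>1 / m\<close>, and
  \<open>Q v = (I - J) (C y + v - s C C\<^sup>T v)\<close> the fixed-point map. A point \<open>v\<close> is fixed by \<open>Q\<close> exactly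
  when \<open>m v \<in> M (C x)\<close> for \<open>x = y - s C\<^sup>T v\<close>, and then \<open>y = x + l C\<^sup>T (m v)\<close>, so that \<open>x\<close> solves the
  resolvent inclusion; conversely a solution \<open>y = x + l C\<^sup>T w\<close> with \<open>w \<in> M (C x)\<close> yields the fixed point
  \<open>w / m\<close>. Fixed points therefore exist as soon as the resolvent is nonempty, and every one of them
  gives the same resolvent point, because the composite operator is monotone
  (\<open>fixed_point_map_eq_self_iff\<close>, \<open>monotone_resolvent_unique\<close>).

  The map \<open>I - J\<close> does not increase distances, and
  \<open>\<parallel>d - s C C\<^sup>T d\<parallel>\<^sup>2 = \<parallel>d\<parallel>\<^sup>2 - 2 s \<parallel>C\<^sup>T d\<parallel>\<^sup>2 + s\<^sup>2 \<parallel>C C\<^sup>T d\<parallel>\<^sup>2\<close>. Hence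
  \<open>\<parallel>Q v - Q w\<parallel>\<^sup>2 \<le> \<parallel>v - w\<parallel>\<^sup>2 - s (2 - s \<parallel>C\<parallel>\<^sup>2) \<parallel>C\<^sup>T (v - w)\<parallel>\<^sup>2\<close> (\<open>fixed_point_map_contraction\<close>).
  Since \<open>s \<parallel>C\<parallel>\<^sup>2 < 2\<close>, the map \<open>Q\<close> is nonexpansive and the Krasnoselskii--Mann iteration converges
  weakly (\<open>weak_convergence\<close>). The extra term is what gives strong convergence: summing the decrease of
  the distance to a fixed point \<open>c\<close> shows that \<open>\<alpha> k * \<parallel>C\<^sup>T (u k - c)\<parallel>\<^sup>2\<close> is summable, so
  \<open>C\<^sup>T (u k)\<close> tends to \<open>C\<^sup>T c\<close> in norm when the weights stay away from \<open>0\<close>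
  (\<open>contracted_quantity_tendsto_zero\<close>).

  The functional analysis behind this is drawn from one variational principle, \<open>strongly_convex_minimizer\<close>:
  a proper convex lower semicontinuous function plus \<open>\<parallel>p\<parallel>\<^sup>2 / 2\<close>, if bounded below, has a minimizer around which
  it grows quadratically. Applied to a bounded linear functional, it is the Riesz representation theorem;
  applied to the Fitzpatrick function of a maximal monotone operator, it is Minty's theorem, which makes
  \<open>J\<close> everywhere defined; applied to an upper limit of \<open>\<parallel>u k - x\<parallel>\<^sup>2\<close>, it yields asymptotic centres. These
  centres take the place of weak compactness and demiclosedness: a nonexpansive map with vanishing
  residuals fixes them, and if all subsequences have the same centre then it is the weak limit.
\<close>

section \<open>Strongly convex minimization\<close>

lemma norm_convex_combination_sq:
  fixes x y :: "'a::real_inner"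
  shows "(norm ((1 - a) *\<^sub>R x + a *\<^sub>R y))\<^sup>2
    = (1 - a) * (norm x)\<^sup>2 + a * (norm y)\<^sup>2 - a * (1 - a) * (norm (x - y))\<^sup>2"
  unfolding power2_norm_eq_inner
  by (simp add: inner_add_left inner_add_right inner_diff_left inner_diff_right inner_commute)
     (simp add: algebra_simps)

text \<open>
  A lower semicontinuous convex function that may take the value \<open>\<infinity>\<close> is represented by its closed convex
  epigraph \<open>E\<close>, on which the height is the linear function \<open>snd\<close>. By the parallelogram identity, two
  points whose values are close to the infimum are close to each other, since otherwise their midpoint
  would fall below it; minimizing sequences are thus Cauchy. The same convexity estimate on the
  segment from the minimizer to another point gives the quadratic growth.
\<close>

lemma strongly_convex_minimizer:
  fixes E :: "('a::{real_inner, complete_space} \<times> real) set"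
  assumes "closed E" "convex E" "E \<noteq> {}"
    and lower: "\<And>p t. (p, t) \<in> E \<Longrightarrow> b \<le> t + (norm p)\<^sup>2 / 2"
  obtains p t where "(p, t) \<in> E"
    and "\<And>q s. (q, s) \<in> E \<Longrightarrow> t + (norm p)\<^sup>2 / 2 + (norm (q - p))\<^sup>2 / 2 \<le> s + (norm q)\<^sup>2 / 2"
proof -
  define \<phi> where "\<phi> = (\<lambda>e::'a \<times> real. snd e + (norm (fst e))\<^sup>2 / 2)"
  define d where "d = Inf (\<phi> ` E)"
  have bdd: "bdd_below (\<phi> ` E)"
    using lower by (auto intro!: bdd_belowI[of _ b] simp: \<phi>_def)
  have d_le: "d \<le> \<phi> e" if "e \<in> E" for e
    unfolding d_def using bdd that by (simp add: cInf_lower)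
  have \<phi>_combination: "\<phi> ((1 - a) *\<^sub>R e + a *\<^sub>R e')
      = (1 - a) * \<phi> e + a * \<phi> e' - a * (1 - a) * (norm (fst e - fst e'))\<^sup>2 / 2" for a e e'
    using norm_convex_combination_sq[of a "fst e" "fst e'"]
    by (simp add: \<phi>_def field_simps)
  have gap: "a * (1 - a) * (norm (fst e - fst e'))\<^sup>2 / 2 \<le> (1 - a) * \<phi> e + a * \<phi> e' - d"
    if "e \<in> E" "e' \<in> E" "0 \<le> a" "a \<le> 1" for a e e'
  proof -
    have "(1 - a) *\<^sub>R e + a *\<^sub>R e' \<in> E"
      using \<open>convex E\<close> that by (simp add: convexD)
    from d_le[OF this] show ?thesis
      unfolding \<phi>_combination by linarith
  qed
  define \<epsilon> where "\<epsilon> = (\<lambda>n. inverse (real (Suc n)))"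
  have \<epsilon>: "0 < \<epsilon> n" "\<epsilon> n \<le> 1" for n
    by (simp_all add: \<epsilon>_def field_simps)
  have inv0: "\<epsilon> \<longlonglongrightarrow> 0"
    unfolding \<epsilon>_def by (rule LIMSEQ_inverse_real_of_nat)
  have "\<exists>e\<in>E. \<phi> e < d + \<epsilon> n" for n
    using cInf_less_iff[OF _ bdd, of "d + \<epsilon> n"] \<open>E \<noteq> {}\<close>
    unfolding d_def using \<epsilon>(1)[of n] by auto
  then obtain e where eE: "\<And>n. e n \<in> E" and \<phi>e: "\<And>n. \<phi> (e n) < d + \<epsilon> n"
    by metis
  \<comment> \<open>The weight \<open>1 / 2\<close> turns the convexity gap into the parallelogram estimate.\<close>
  have near: "(norm (fst (e i) - fst (e j)))\<^sup>2 \<le> 4 * (\<epsilon> i + \<epsilon> j)"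
    for i j
  proof -
    have "(norm (fst (e i) - fst (e j)))\<^sup>2 / 8 \<le> \<phi> (e i) / 2 + \<phi> (e j) / 2 - d"
      using gap[OF eE eE, of "1/2" i j] by simp
    then show ?thesis using \<phi>e[of i] \<phi>e[of j] unfolding distrib_left by linarith
  qed
  have "Cauchy (\<lambda>n. fst (e n))"
  proof (rule metric_CauchyI)
    fix r :: real assume "0 < r"
    then have "\<forall>\<^sub>F n in sequentially. \<epsilon> n < r\<^sup>2 / 8"
      using inv0 by (intro order_tendstoD(2)[OF inv0]) auto
    then obtain N where N: "\<And>n. n \<ge> N \<Longrightarrow> \<epsilon> n < r\<^sup>2 / 8"
      unfolding eventually_sequentially by auto
    have "dist (fst (e i)) (fst (e j)) < r" if "i \<ge> N" "j \<ge> N" for i j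
    proof -
      have "(norm (fst (e i) - fst (e j)))\<^sup>2 < r\<^sup>2"
        using near[of i j] N[OF that(1)] N[OF that(2)] unfolding distrib_left by linarith
      then show ?thesis
        using \<open>0 < r\<close> power_less_imp_less_base[of _ 2 r] by (auto simp: dist_norm)
    qed
    then show "\<exists>N. \<forall>i\<ge>N. \<forall>j\<ge>N. dist (fst (e i)) (fst (e j)) < r"
      by blast
  qed
  then obtain p where p: "(\<lambda>n. fst (e n)) \<longlonglongrightarrow> p"
    using Cauchy_convergent_iff convergent_def by blast
  have "(\<lambda>n. \<phi> (e n)) \<longlonglongrightarrow> d"
  proof (rule tendsto_sandwich)
    show "\<forall>\<^sub>F n in sequentially. d \<le> \<phi> (e n)" using d_le eE by simp
    show "\<forall>\<^sub>F n in sequentially. \<phi> (e n) \<le> d + \<epsilon> n"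
      using \<phi>e by (simp add: less_imp_le)
    show "(\<lambda>n. d + \<epsilon> n) \<longlonglongrightarrow> d"
      using tendsto_add[OF tendsto_const inv0, of d] by simp
  qed simp
  then have "(\<lambda>n. \<phi> (e n) - (norm (fst (e n)))\<^sup>2 / 2) \<longlonglongrightarrow> d - (norm p)\<^sup>2 / 2"
    by (intro tendsto_intros p) simp_all
  then have "(\<lambda>n. snd (e n)) \<longlonglongrightarrow> d - (norm p)\<^sup>2 / 2"
    by (simp add: \<phi>_def)
  from tendsto_Pair[OF p this] have "e \<longlonglongrightarrow> (p, d - (norm p)\<^sup>2 / 2)" by simp
  then have pE: "(p, d - (norm p)\<^sup>2 / 2) \<in> E"
    using \<open>closed E\<close> eE closed_sequentially by blast
  have "d + (norm (q - p))\<^sup>2 / 2 \<le> s + (norm q)\<^sup>2 / 2" if "(q, s) \<in> E" for q s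
  proof -
    \<comment> \<open>Moving from \<open>p\<close> towards \<open>q\<close> by \<open>\<epsilon> n\<close> gains a factor \<open>1 - \<epsilon> n\<close> of the growth, which tends to 1.\<close>
    have "(1 - \<epsilon> n) * (norm (p - q))\<^sup>2 / 2 \<le> \<phi> (q, s) - d" for n
    proof -
      let ?a = "\<epsilon> n"
      have "?a * (1 - ?a) * (norm (p - q))\<^sup>2 / 2 \<le> (1 - ?a) * d + ?a * \<phi> (q, s) - d"
        using gap[OF pE that, of ?a] \<epsilon>[of n] by (simp add: \<phi>_def)
      then have "?a * ((1 - ?a) * (norm (p - q))\<^sup>2 / 2) \<le> ?a * (\<phi> (q, s) - d)"
        by (simp add: algebra_simps)
      then show ?thesis
        using \<epsilon>(1)[of n] by (simp only: mult_le_cancel_left_pos)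
    qed
    moreover have "(\<lambda>n. (1 - \<epsilon> n) * (norm (p - q))\<^sup>2 / 2)
        \<longlonglongrightarrow> (1 - 0) * (norm (p - q))\<^sup>2 / 2"
      by (intro tendsto_intros inv0) simp_all
    ultimately have "(1 - 0) * (norm (p - q))\<^sup>2 / 2 \<le> \<phi> (q, s) - d"
      by (intro LIMSEQ_le_const2) auto
    then show ?thesis by (simp add: \<phi>_def norm_minus_commute)
  qed
  then show ?thesis using that[OF pE] by simp
qed

section \<open>The Riesz representation and adjoints\<close>

text \<open>
  At the minimizer \<open>p\<close> of \<open>f x + \<parallel>x\<parallel>\<^sup>2 / 2\<close> the derivative \<open>f + p \<bullet> _\<close> vanishes, so \<open>- p\<close> represents \<open>f\<close>.
\<close>

lemma riesz_representation:
  fixes f :: "'a::{real_inner, complete_space} \<Rightarrow> real"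
  assumes "bounded_linear f"
  obtains w where "\<And>x. f x = w \<bullet> x"
proof -
  interpret bounded_linear f by fact
  let ?E = "{(x, t). f x \<le> t}"
  obtain K where K: "\<And>x. norm (f x) \<le> norm x * K" using bounded by blast
  have cl: "closed ?E"
    unfolding case_prod_beta
    by (intro closed_Collect_le continuous_intros continuous_on continuous_on_snd continuous_on_fst)
  have cv: "convex ?E"
    by (auto simp: convex_def add scaleR intro!: add_mono mult_left_mono)
  have lb: "- K\<^sup>2 / 2 \<le> t + (norm x)\<^sup>2 / 2" if "(x, t) \<in> ?E" for x t
  proof -
    have "- (norm x * K) \<le> t" using K[of x] that by auto
    moreover have "0 \<le> (norm x - K)\<^sup>2" by simp
    ultimately show ?thesis by (simp add: power2_diff)
  qed
  have "?E \<noteq> {}" by auto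
  from strongly_convex_minimizer[OF cl cv this lb] obtain p t where
    pt: "(p, t) \<in> ?E"
    and min: "\<And>q s. (q, s) \<in> ?E \<Longrightarrow> t + (norm p)\<^sup>2 / 2 + (norm (q - p))\<^sup>2 / 2 \<le> s + (norm q)\<^sup>2 / 2"
    by blast
  have ge: "0 \<le> f h + p \<bullet> h" for h
    using min[of "p + h" "f (p + h)"] pt
    by (simp add: add power2_norm_eq_inner inner_add_left inner_add_right inner_commute field_simps)
  have "f x = (- p) \<bullet> x" for x
    using ge[of x] ge[of "- x"] by (simp add: neg)
  then show ?thesis by (rule that)
qed

text \<open>
  The constant \<open>adjoint\<close> is a choice among the maps with this property; the Riesz theorem shows that one
  exists.
\<close>

lemma adjoint_inner:
  fixes C :: "'a::{real_inner, complete_space} \<Rightarrow> 'b::real_inner"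
  assumes "bounded_linear C"
  shows "C x \<bullet> v = x \<bullet> adjoint C v"
proof -
  have "\<exists>w. \<forall>x. C x \<bullet> v = x \<bullet> w" for v
  proof -
    have "bounded_linear (\<lambda>x. C x \<bullet> v)"
      by (rule bounded_linear_compose[OF bounded_linear_inner_left assms])
    from riesz_representation[OF this] obtain w where "\<And>x. C x \<bullet> v = w \<bullet> x" by blast
    then show ?thesis by (auto simp: inner_commute)
  qed
  then have "\<exists>g. \<forall>x v. C x \<bullet> v = x \<bullet> g v" by metis
  then show ?thesis
    unfolding adjoint_def by (rule someI2_ex) blast
qed

lemma linear_adjoint:
  fixes C :: "'a::{real_inner, complete_space} \<Rightarrow> 'b::real_inner"
  assumes "bounded_linear C"
  shows "linear (adjoint C)"
proof (rule linearI)
  show "adjoint C (v + w) = adjoint C v + adjoint C w" for v w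
    by (subst vector_eq_ldot[symmetric])
       (simp add: inner_add_right flip: adjoint_inner[OF assms])
  show "adjoint C (r *\<^sub>R v) = r *\<^sub>R adjoint C v" for r v
    by (subst vector_eq_ldot[symmetric]) (simp flip: adjoint_inner[OF assms])
qed

section \<open>Maximal monotone operators and their resolvents\<close>

text \<open>
  The graph of \<open>A\<close> enlarged by the single pair \<open>(x, v)\<close> is still monotone, so it is the graph of \<open>A\<close>.
\<close>

lemma maximal_monotone_memI:
  assumes "maximal_monotone A" and related: "\<And>a b. b \<in> A a \<Longrightarrow> 0 \<le> (x - a) \<bullet> (v - b)"
  shows "v \<in> A x"
proof -
  let ?B = "A(x := insert v (A x))"
  have mono: "0 \<le> (a - a') \<bullet> (b - b')" if "b \<in> A a" "b' \<in> A a'" for a a' b b'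
    using assms(1) that unfolding maximal_monotone_def monotone_operator_def by blast
  have "0 \<le> (a - x) \<bullet> (b - v)" if "b \<in> A a" for a b
    using related[OF that] by (simp add: inner_diff_left inner_diff_right)
  then have "monotone_operator ?B"
    using related mono unfolding monotone_operator_def by (auto split: if_splits)
  moreover have "\<forall>a. A a \<subseteq> ?B a" by auto
  ultimately have "?B = A"
    using assms(1) unfolding maximal_monotone_def by blast
  then show ?thesis by (metis fun_upd_same insertI1)
qed

text \<open>
  The Fitzpatrick function of \<open>G\<close> is \<open>(x, v) \<mapsto> Sup {x \<bullet> b + a \<bullet> v - a \<bullet> b | (a, b) \<in> G}\<close>, here given by its
  epigraph. Maximality makes it at least \<open>x \<bullet> v\<close>, and monotonicity makes it equal to \<open>a \<bullet> b\<close> at each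
  \<open>(a, b) \<in> G\<close>. Adding \<open>(\<parallel>x\<parallel>\<^sup>2 + \<parallel>v\<parallel>\<^sup>2) / 2\<close> gives a function bounded below by \<open>\<parallel>x + v\<parallel>\<^sup>2 / 2\<close>. Comparing
  its minimizer \<open>(x, v)\<close> with the points of \<open>G\<close> shows \<open>\<parallel>x + v\<parallel>\<^sup>2 \<le> (a + v) \<bullet> (b + x)\<close> for all of them, so
  \<open>(- v, - x)\<close> is monotonically related to \<open>G\<close> and hence in it; taking it as \<open>(a, b)\<close> gives \<open>v = - x\<close>.
\<close>

lemma minty_relation:
  fixes G :: "('b::{real_inner, complete_space} \<times> 'b) set"
  assumes mono: "\<And>a b a' b'. (a, b) \<in> G \<Longrightarrow> (a', b') \<in> G \<Longrightarrow> 0 \<le> (a - a') \<bullet> (b - b')"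
    and maxi: "\<And>x v. (\<And>a b. (a, b) \<in> G \<Longrightarrow> 0 \<le> (x - a) \<bullet> (v - b)) \<Longrightarrow> (x, v) \<in> G"
  shows "\<exists>x. (x, - x) \<in> G"
proof -
  let ?E = "{(p, t). \<forall>(a, b) \<in> G. fst p \<bullet> b + a \<bullet> snd p - a \<bullet> b \<le> t} :: (('b \<times> 'b) \<times> real) set"
  have norm_pair: "(norm (x, v))\<^sup>2 = x \<bullet> x + v \<bullet> v" for x v :: 'b
    by (simp add: norm_Pair power2_norm_eq_inner)
  have "?E = (\<Inter>(a, b)\<in>G. {e. fst (fst e) \<bullet> b + a \<bullet> snd (fst e) - a \<bullet> b \<le> snd e})"
    by auto
  moreover have "closed \<dots>"
    by (intro closed_INT ballI) (auto intro!: closed_Collect_le continuous_intros)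
  ultimately have cl: "closed ?E" by simp
  have cv: "convex ?E"
  proof (rule convexI)
    fix e e' :: "('b \<times> 'b) \<times> real" and r s :: real
    assume e: "e \<in> ?E" "e' \<in> ?E" and rs: "0 \<le> r" "0 \<le> s" "r + s = 1"
    obtain x v t x' v' t' where ee: "e = ((x, v), t)" "e' = ((x', v'), t')"
      by (metis surj_pair)
    have "(r *\<^sub>R x + s *\<^sub>R x') \<bullet> b + a \<bullet> (r *\<^sub>R v + s *\<^sub>R v') - a \<bullet> b \<le> r * t + s * t'"
      if ab: "(a, b) \<in> G" for a b
    proof -
      have "r * (x \<bullet> b + a \<bullet> v - a \<bullet> b) + s * (x' \<bullet> b + a \<bullet> v' - a \<bullet> b) \<le> r * t + s * t'"
        using e ab rs unfolding ee by (intro add_mono mult_left_mono) auto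
      moreover have "r * (a \<bullet> b) + s * (a \<bullet> b) = a \<bullet> b"
        using rs(3) by (metis distrib_right mult_1)
      ultimately show ?thesis
        by (simp add: inner_add_left inner_add_right right_diff_distrib distrib_left)
    qed
    then show "r *\<^sub>R e + s *\<^sub>R e' \<in> ?E" unfolding ee by auto
  qed
  have above: "x \<bullet> v \<le> t" if E: "((x, v), t) \<in> ?E" for x v t
  proof (rule ccontr)
    assume less: "\<not> x \<bullet> v \<le> t"
    have "0 \<le> (x - a) \<bullet> (v - b)" if "(a, b) \<in> G" for a b
    proof -
      have "x \<bullet> b + a \<bullet> v - a \<bullet> b \<le> t" using E that by auto
      then show ?thesis using less by (simp add: inner_diff_left inner_diff_right)
    qed
    then have "(x, v) \<in> G" by (rule maxi)
    then have "x \<bullet> v + x \<bullet> v - x \<bullet> v \<le> t" using E by auto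
    then show False using less by simp
  qed
  have lb: "0 \<le> t + (norm p)\<^sup>2 / 2" if "(p, t) \<in> ?E" for p t
  proof -
    obtain x v where p: "p = (x, v)" by (cases p)
    have "0 \<le> (norm (x + v))\<^sup>2 / 2" by simp
    also have "\<dots> = x \<bullet> v + (norm p)\<^sup>2 / 2"
      unfolding p norm_pair unfolding power2_norm_eq_inner
      by (simp add: inner_add_left inner_add_right inner_commute)
    also have "\<dots> \<le> t + (norm p)\<^sup>2 / 2" using above[of x v t] that p by simp
    finally show ?thesis .
  qed
  have graph: "((a, b), a \<bullet> b) \<in> ?E" if "(a, b) \<in> G" for a b
    using mono[OF that] by (force simp: inner_diff_left inner_diff_right)
  have "G \<noteq> {}" using maxi[of 0 0] by auto
  then have "?E \<noteq> {}" using graph by fast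
  from strongly_convex_minimizer[OF cl cv this lb] obtain p t where
    pt: "(p, t) \<in> ?E"
    and min: "\<And>q s. (q, s) \<in> ?E \<Longrightarrow> t + (norm p)\<^sup>2 / 2 + (norm (q - p))\<^sup>2 / 2 \<le> s + (norm q)\<^sup>2 / 2"
    by blast
  obtain x v where p: "p = (x, v)" by (cases p)
  have key: "(norm (x + v))\<^sup>2 \<le> (a + v) \<bullet> (b + x)" if "(a, b) \<in> G" for a b
  proof -
    have "t + (x \<bullet> x + v \<bullet> v) / 2 + ((a - x) \<bullet> (a - x) + (b - v) \<bullet> (b - v)) / 2
        \<le> a \<bullet> b + (a \<bullet> a + b \<bullet> b) / 2"
      using min[OF graph[OF that]] unfolding p by (simp add: norm_pair)
    moreover have "x \<bullet> v \<le> t" using above pt p by simp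
    ultimately show ?thesis
      unfolding power2_norm_eq_inner
      by (simp add: inner_add_left inner_add_right inner_diff_left inner_diff_right inner_commute
          field_simps)
  qed
  have "(- v, - x) \<in> G"
  proof (rule maxi)
    fix a b assume "(a, b) \<in> G"
    from key[OF this] have "0 \<le> (a + v) \<bullet> (b + x)"
      using zero_le_power2 order_trans by blast
    then show "0 \<le> (- v - a) \<bullet> (- x - b)"
      by (simp add: inner_add_left inner_add_right inner_diff_left inner_diff_right)
  qed
  moreover from key[OF this] have "v = - x"
    by (simp add: add_eq_0_iff)
  ultimately show ?thesis by auto
qed

lemma resolvent_scale_operator_iff:
  "x \<in> resolvent (scale_operator c A) z \<longleftrightarrow> (\<exists>w\<in>A x. z = x + c *\<^sub>R w)"
  unfolding resolvent_def scale_operator_def by auto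

lemma monotone_resolvent_unique:
  assumes "monotone_operator A" "0 \<le> c"
    and "x \<in> resolvent (scale_operator c A) z" "x' \<in> resolvent (scale_operator c A) z"
  shows "x = x'"
proof -
  obtain w w' where w: "w \<in> A x" "z = x + c *\<^sub>R w" "w' \<in> A x'" "z = x' + c *\<^sub>R w'"
    using assms(3,4) unfolding resolvent_scale_operator_iff by blast
  have "0 \<le> c * ((x - x') \<bullet> (w - w'))"
    using assms(1,2) w(1,3) unfolding monotone_operator_def by auto
  also have "\<dots> = (x - x') \<bullet> (c *\<^sub>R w - c *\<^sub>R w')" by (simp add: inner_diff_right right_diff_distrib)
  also have "c *\<^sub>R w - c *\<^sub>R w' = - (x - x')"
    using w(2,4) by (simp add: algebra_simps)
  finally have "(x - x') \<bullet> (x - x') \<le> 0" unfolding inner_minus_right by simp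
  then show ?thesis by (metis inner_eq_zero_iff inner_ge_zero order_antisym right_minus_eq)
qed

text \<open>
  Solving \<open>z = a + c b\<close> with \<open>b \<in> A a\<close> means finding a pair of the form \<open>(x, - x)\<close> in the graph of \<open>A\<close>
  translated by \<open>- z\<close> in the argument and scaled by \<open>c\<close> in the value, which is again maximal monotone.
\<close>

theorem minty:
  fixes A :: "'b::{real_inner, complete_space} \<Rightarrow> 'b set"
  assumes "maximal_monotone A" "0 < c"
  shows "resolvent (scale_operator c A) z \<noteq> {}"
proof -
  define G where "G = {(a - z, c *\<^sub>R b) | a b. b \<in> A a}"
  have "\<exists>x. (x, - x) \<in> G"
  proof (rule minty_relation)
    fix a b a' b' assume "(a, b) \<in> G" "(a', b') \<in> G"
    then obtain \<beta> \<beta>' where \<beta>: "\<beta> \<in> A (a + z)" "b = c *\<^sub>R \<beta>" "\<beta>' \<in> A (a' + z)" "b' = c *\<^sub>R \<beta>'"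
      unfolding G_def by auto
    then have "0 \<le> c * ((a + z - (a' + z)) \<bullet> (\<beta> - \<beta>'))"
      using assms unfolding maximal_monotone_def monotone_operator_def
      by (metis less_imp_le mult_nonneg_nonneg)
    then show "0 \<le> (a - a') \<bullet> (b - b')"
      using \<beta> by (simp add: inner_diff_right right_diff_distrib)
  next
    fix x v assume rel: "\<And>a b. (a, b) \<in> G \<Longrightarrow> 0 \<le> (x - a) \<bullet> (v - b)"
    have "(1 / c) *\<^sub>R v \<in> A (x + z)"
    proof (rule maximal_monotone_memI[OF assms(1)])
      fix a b assume "b \<in> A a"
      then have "0 \<le> (1 / c) * ((x - (a - z)) \<bullet> (v - c *\<^sub>R b))"
        using rel[of "a - z" "c *\<^sub>R b"] \<open>0 < c\<close> unfolding G_def by auto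
      also have "\<dots> = (x - (a - z)) \<bullet> ((1 / c) *\<^sub>R (v - c *\<^sub>R b))" by simp
      also have "(1 / c) *\<^sub>R (v - c *\<^sub>R b) = (1 / c) *\<^sub>R v - b"
        using \<open>0 < c\<close> by (simp add: scaleR_diff_right)
      finally show "0 \<le> (x + z - a) \<bullet> ((1 / c) *\<^sub>R v - b)"
        by (simp add: algebra_simps)
    qed
    then show "(x, v) \<in> G"
      unfolding G_def using \<open>0 < c\<close>
      by (intro CollectI exI[of _ "x + z"] exI[of _ "(1 / c) *\<^sub>R v"]) auto
  qed
  then obtain a b where "b \<in> A a" "c *\<^sub>R b = - (a - z)" unfolding G_def by auto
  then have "a \<in> resolvent (scale_operator c A) z"
    unfolding resolvent_scale_operator_iff by (intro bexI[of _ b]) simp_all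
  then show ?thesis by blast
qed

lemma resolvent_eq_singleton:
  assumes "monotone_operator A" "0 \<le> c" "x \<in> resolvent (scale_operator c A) z"
  shows "resolvent (scale_operator c A) z = {x}"
  using monotone_resolvent_unique[OF assms(1,2)] assms(3) by blast

lemma resolvent_point_eq:
  assumes "monotone_operator A" "0 \<le> c" "x \<in> resolvent (scale_operator c A) z"
  shows "resolvent_point (scale_operator c A) z = x"
  unfolding resolvent_point_def resolvent_eq_singleton[OF assms] by simp

lemma resolvent_point_mem:
  fixes A :: "'b::{real_inner, complete_space} \<Rightarrow> 'b set"
  assumes "maximal_monotone A" "0 < c"
  shows "resolvent_point (scale_operator c A) z \<in> resolvent (scale_operator c A) z"
  using minty[OF assms, of z] resolvent_point_eq[of A c _ z] assms
  unfolding maximal_monotone_def by fastforce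

text \<open>
  Monotonicity says that the increments \<open>d\<close> of \<open>J\<close> and \<open>e\<close> of \<open>I - J\<close> satisfy \<open>0 \<le> d \<bullet> e\<close>; as \<open>d + e\<close> is the
  increment of the argument, \<open>\<parallel>e\<parallel>\<^sup>2 \<le> \<parallel>d + e\<parallel>\<^sup>2\<close>.
\<close>

lemma resolvent_complement_nonexpansive:
  fixes A :: "'b::{real_inner, complete_space} \<Rightarrow> 'b set"
  assumes "maximal_monotone A" "0 < c"
  defines "J \<equiv> resolvent_point (scale_operator c A)"
  shows "norm ((z - J z) - (z' - J z')) \<le> norm (z - z')"
proof -
  obtain w w' where w: "w \<in> A (J z)" "z = J z + c *\<^sub>R w" "w' \<in> A (J z')" "z' = J z' + c *\<^sub>R w'"
    using resolvent_point_mem[OF assms(1,2)] unfolding J_def resolvent_scale_operator_iff by metis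
  define d where "d = J z - J z'"
  define e where "e = (z - J z) - (z' - J z')"
  have e: "e = c *\<^sub>R (w - w')"
    using w(2,4) unfolding e_def by (metis add_diff_cancel_left' scaleR_diff_right)
  have "0 \<le> d \<bullet> (w - w')"
    using assms(1) w(1,3) unfolding d_def maximal_monotone_def monotone_operator_def by blast
  then have "0 \<le> d \<bullet> e" using \<open>0 < c\<close> unfolding e by simp
  moreover have "z - z' = d + e" unfolding d_def e_def by simp
  ultimately have "(norm e)\<^sup>2 \<le> (norm (z - z'))\<^sup>2"
    unfolding power2_norm_eq_inner by (simp add: inner_add_left inner_add_right inner_commute)
  then show ?thesis unfolding e_def by (rule power2_le_imp_le) simp
qed

section \<open>Asymptotic centres and weak convergence\<close>

text \<open>
  With \<open>\<psi> x\<close> the upper limit of \<open>\<parallel>u k - x\<parallel>\<^sup>2\<close> along \<open>F\<close>, this says that \<open>\<psi> c \<le> r\<close> and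
  \<open>r + \<parallel>x - c\<parallel>\<^sup>2 \<le> \<psi> x\<close> for all \<open>x\<close>: the point \<open>c\<close> minimizes \<open>\<psi>\<close>, with minimum \<open>r\<close> and quadratic growth.
  Filters finer than \<open>sequentially\<close> serve as subsequences.
\<close>

definition asymptotic_centre ::
    "'i filter \<Rightarrow> ('i \<Rightarrow> 'a::real_inner) \<Rightarrow> 'a \<Rightarrow> real \<Rightarrow> bool" where
  "asymptotic_centre F u c r \<longleftrightarrow>
     (\<forall>e>0. \<forall>\<^sub>F k in F. (norm (u k - c))\<^sup>2 \<le> r + e) \<and>
     (\<forall>x t. (\<forall>\<^sub>F k in F. (norm (u k - x))\<^sup>2 \<le> t) \<longrightarrow> r + (norm (x - c))\<^sup>2 \<le> t)"

lemma norm_diff_sq: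
  fixes x y :: "'a::real_inner"
  shows "(norm (x - y))\<^sup>2 = (norm x)\<^sup>2 - 2 * (x \<bullet> y) + (norm y)\<^sup>2"
  unfolding power2_norm_eq_inner by (simp add: inner_diff_left inner_diff_right inner_commute)

text \<open>
  Expanding \<open>\<parallel>u k - x\<parallel>\<^sup>2 / 2\<close> separates the strongly convex part \<open>\<parallel>x\<parallel>\<^sup>2 / 2\<close> from an upper limit of the
  functions \<open>\<parallel>u k\<parallel>\<^sup>2 / 2 - u k \<bullet> x\<close>, which are affine in \<open>x\<close> with a common Lipschitz constant; the upper
  limit is therefore convex and continuous.
\<close>

lemma asymptotic_centre_exists:
  fixes u :: "'i \<Rightarrow> 'a::{real_inner, complete_space}"
  assumes "F \<noteq> bot" and B: "\<And>k. norm (u k) \<le> B"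
  obtains c r where "asymptotic_centre F u c r"
proof -
  let ?E = "{(x, t). \<forall>e>0. \<forall>\<^sub>F k in F. (norm (u k))\<^sup>2 / 2 - u k \<bullet> x \<le> t + e}"
  have cl: "closed ?E"
    unfolding closed_sequential_limits
  proof (intro allI impI, elim conjE)
    fix s l assume sE: "\<forall>n. s n \<in> ?E" and lim: "s \<longlonglongrightarrow> l"
    obtain x t where l: "l = (x, t)" by (cases l)
    have "\<forall>\<^sub>F k in F. (norm (u k))\<^sup>2 / 2 - u k \<bullet> x \<le> t + e" if "0 < e" for e
    proof -
      have "(\<lambda>n. snd (s n) + B * norm (fst (s n) - x)) \<longlonglongrightarrow> t + B * norm (x - x)"
        using tendsto_fst[OF lim] tendsto_snd[OF lim] unfolding l by (intro tendsto_intros) auto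
      then have "\<forall>\<^sub>F n in sequentially. snd (s n) + B * norm (fst (s n) - x) < t + e / 2"
        using \<open>0 < e\<close> by (intro order_tendstoD(2)[of _ t]) auto
      then obtain n where n: "snd (s n) + B * norm (fst (s n) - x) < t + e / 2"
        by (auto simp: eventually_sequentially)
      have "\<forall>\<^sub>F k in F. (norm (u k))\<^sup>2 / 2 - u k \<bullet> fst (s n) \<le> snd (s n) + e / 2"
        using sE[rule_format, of n] \<open>0 < e\<close> by (auto simp: case_prod_beta)
      then show ?thesis
      proof eventually_elim
        case (elim k)
        have "u k \<bullet> (fst (s n) - x) \<le> norm (u k) * norm (fst (s n) - x)"
          by (rule norm_cauchy_schwarz)
        also have "\<dots> \<le> B * norm (fst (s n) - x)"
          by (intro mult_right_mono B) simp
        finally show ?case using elim n by (simp add: inner_diff_right)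
      qed
    qed
    then show "l \<in> ?E" unfolding l by simp
  qed
  have cv: "convex ?E"
  proof (rule convexI)
    fix p q and a b :: real
    assume pq: "p \<in> ?E" "q \<in> ?E" and ab: "0 \<le> a" "0 \<le> b" "a + b = 1"
    obtain x t x' t' where eq: "p = (x, t)" "q = (x', t')" by (metis surj_pair)
    have "\<forall>\<^sub>F k in F. (norm (u k))\<^sup>2 / 2 - u k \<bullet> (a *\<^sub>R x + b *\<^sub>R x') \<le> a * t + b * t' + e"
      if "0 < e" for e
    proof -
      have "\<forall>\<^sub>F k in F. (norm (u k))\<^sup>2 / 2 - u k \<bullet> x \<le> t + e"
        "\<forall>\<^sub>F k in F. (norm (u k))\<^sup>2 / 2 - u k \<bullet> x' \<le> t' + e"
        using pq \<open>0 < e\<close> unfolding eq by auto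
      then show ?thesis
      proof eventually_elim
        case (elim k)
        let ?h = "(norm (u k))\<^sup>2 / 2"
        have "a * (?h - u k \<bullet> x) + b * (?h - u k \<bullet> x') \<le> a * (t + e) + b * (t' + e)"
          using elim ab by (intro add_mono mult_left_mono) auto
        moreover have "a * ?h + b * ?h = ?h" "a * e + b * e = e"
          using ab(3) by (metis distrib_right mult_1)+
        ultimately show ?case
          by (simp add: inner_add_right right_diff_distrib distrib_left)
      qed
    qed
    then show "a *\<^sub>R p + b *\<^sub>R q \<in> ?E" unfolding eq by simp
  qed
  have "(norm (u k))\<^sup>2 / 2 \<le> B\<^sup>2 / 2" for k
    using power_mono[OF B, of k 2] by simp
  then have "(0, B\<^sup>2 / 2) \<in> ?E" by (auto intro!: always_eventually add_increasing2)
  then have ne: "?E \<noteq> {}" by blast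
  have lb: "0 \<le> t + (norm x)\<^sup>2 / 2" if "(x, t) \<in> ?E" for x t
  proof (rule field_le_epsilon)
    fix e :: real assume "0 < e"
    then have "\<forall>\<^sub>F k in F. (norm (u k))\<^sup>2 / 2 - u k \<bullet> x \<le> t + e" using that by simp
    then obtain k where "(norm (u k))\<^sup>2 / 2 - u k \<bullet> x \<le> t + e"
      using eventually_happens'[OF \<open>F \<noteq> bot\<close>] by blast
    moreover have "0 \<le> (norm (u k - x))\<^sup>2" by simp
    ultimately show "0 \<le> t + (norm x)\<^sup>2 / 2 + e" unfolding norm_diff_sq by linarith
  qed
  from strongly_convex_minimizer[OF cl cv ne lb] obtain c t where
    ct: "(c, t) \<in> ?E"
    and min: "\<And>q s. (q, s) \<in> ?E \<Longrightarrow> t + (norm c)\<^sup>2 / 2 + (norm (q - c))\<^sup>2 / 2 \<le> s + (norm q)\<^sup>2 / 2"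
    by blast
  have "asymptotic_centre F u c (2 * t + (norm c)\<^sup>2)"
    unfolding asymptotic_centre_def
  proof (intro conjI allI impI)
    fix e :: real assume "0 < e"
    then have "\<forall>\<^sub>F k in F. (norm (u k))\<^sup>2 / 2 - u k \<bullet> c \<le> t + e / 2" using ct by simp
    then show "\<forall>\<^sub>F k in F. (norm (u k - c))\<^sup>2 \<le> 2 * t + (norm c)\<^sup>2 + e"
      by eventually_elim (simp add: norm_diff_sq)
  next
    fix x s assume ev: "\<forall>\<^sub>F k in F. (norm (u k - x))\<^sup>2 \<le> s"
    have "(x, (s - (norm x)\<^sup>2) / 2) \<in> ?E"
    proof (clarsimp)
      fix e :: real assume "0 < e"
      show "\<forall>\<^sub>F k in F. (norm (u k))\<^sup>2 / 2 - u k \<bullet> x \<le> (s - (norm x)\<^sup>2) / 2 + e"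
        using ev
      proof eventually_elim
        case (elim k)
        then show ?case using \<open>0 < e\<close> unfolding norm_diff_sq by (simp add: field_simps)
      qed
    qed
    from min[OF this] show "2 * t + (norm c)\<^sup>2 + (norm (x - c))\<^sup>2 \<le> s"
      by (simp add: field_simps)
  qed
  then show ?thesis by (rule that)
qed

text \<open>
  The point \<open>Q c\<close> is asymptotically as close to the sequence as \<open>c\<close>, since \<open>u k\<close> is close to \<open>Q (u k)\<close> and
  \<open>Q\<close> is nonexpansive; by the growth at the centre it cannot differ from \<open>c\<close>.
\<close>

lemma asymptotic_centre_fixed_point:
  fixes Q :: "'a::real_inner \<Rightarrow> 'a"
  assumes centre: "asymptotic_centre F u c r"
    and nonexp: "\<And>x y. norm (Q x - Q y) \<le> norm (x - y)"
    and B: "\<And>k. norm (u k - c) \<le> B"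
    and residual: "((\<lambda>k. norm (u k - Q (u k))) \<longlongrightarrow> 0) F"
  shows "Q c = c"
proof -
  have "(norm (Q c - c))\<^sup>2 \<le> 0 + e" if "0 < e" for e
  proof -
    let ?d = "\<lambda>k. norm (u k - Q (u k))"
    have "((\<lambda>k. (?d k)\<^sup>2 + 2 * ?d k * B) \<longlongrightarrow> 0\<^sup>2 + 2 * 0 * B) F"
      by (intro tendsto_intros residual)
    then have "\<forall>\<^sub>F k in F. (?d k)\<^sup>2 + 2 * ?d k * B < e / 2"
      using \<open>0 < e\<close> by (intro order_tendstoD(2)[of _ 0]) auto
    moreover have "\<forall>\<^sub>F k in F. (norm (u k - c))\<^sup>2 \<le> r + e / 2"
      using centre \<open>0 < e\<close> unfolding asymptotic_centre_def by (meson half_gt_zero)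
    ultimately have "\<forall>\<^sub>F k in F. (norm (u k - Q c))\<^sup>2 \<le> r + e"
    proof eventually_elim
      case (elim k)
      have "norm (u k - Q c) \<le> ?d k + norm (Q (u k) - Q c)"
        using norm_triangle_ineq[of "u k - Q (u k)" "Q (u k) - Q c"] by simp
      also have "\<dots> \<le> ?d k + norm (u k - c)" using nonexp by simp
      finally have "(norm (u k - Q c))\<^sup>2 \<le> (?d k + norm (u k - c))\<^sup>2"
        by (rule power_mono) simp
      also have "\<dots> = (?d k)\<^sup>2 + 2 * ?d k * norm (u k - c) + (norm (u k - c))\<^sup>2"
        by (rule power2_sum[THEN trans]) simp
      also have "2 * ?d k * norm (u k - c) \<le> 2 * ?d k * B"
        by (intro mult_left_mono B) simp
      finally show ?case using elim by linarith
    qed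
    then have "r + (norm (Q c - c))\<^sup>2 \<le> r + e"
      using centre unfolding asymptotic_centre_def by blast
    then show ?thesis by simp
  qed
  then have "(norm (Q c - c))\<^sup>2 \<le> 0" by (rule field_le_epsilon)
  then show ?thesis by simp
qed

lemma asymptotic_centre_limit_less:
  assumes centre: "asymptotic_centre F u c r"
    and "F \<noteq> bot"
    and c: "((\<lambda>k. (norm (u k - c))\<^sup>2) \<longlongrightarrow> L) F"
    and ev: "\<forall>\<^sub>F k in F. (norm (u k - x))\<^sup>2 \<le> t"
  shows "L + (norm (x - c))\<^sup>2 \<le> t"
proof -
  have "L \<le> r + e" if "0 < e" for e
    using centre that unfolding asymptotic_centre_def
    by (intro tendsto_upperbound[OF c _ \<open>F \<noteq> bot\<close>]) blast
  then have "L \<le> r" by (rule field_le_epsilon)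
  moreover have "r + (norm (x - c))\<^sup>2 \<le> t"
    using centre ev unfolding asymptotic_centre_def by blast
  ultimately show ?thesis by linarith
qed

lemma asymptotic_centre_limit_le:
  assumes "asymptotic_centre F u c r" "F \<noteq> bot"
    and "((\<lambda>k. (norm (u k - c))\<^sup>2) \<longlongrightarrow> L) F"
    and x: "((\<lambda>k. (norm (u k - x))\<^sup>2) \<longlongrightarrow> L') F"
  shows "L + (norm (x - c))\<^sup>2 \<le> L'"
proof (rule field_le_epsilon)
  fix e :: real assume "0 < e"
  then have "\<forall>\<^sub>F k in F. (norm (u k - x))\<^sup>2 < L' + e"
    by (intro order_tendstoD(2)[OF x]) simp
  then have "\<forall>\<^sub>F k in F. (norm (u k - x))\<^sup>2 \<le> L' + e"
    by eventually_elim simp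
  then show "L + (norm (x - c))\<^sup>2 \<le> L' + e"
    by (rule asymptotic_centre_limit_less[OF assms(1-3)])
qed

text \<open>
  Opial's argument with centres in place of weak cluster points. The distances to a point of \<open>S\<close> have a
  limit, which is the same along every finer filter, so two centres in \<open>S\<close> are each at least as good
  as the other and coincide. If \<open>(u k - c) \<bullet> w\<close> stayed above \<open>e > 0\<close> along some finer filter, then along it
  \<open>c + w\<close> would have asymptotic squared distance at most \<open>L - 2 e + \<parallel>w\<parallel>\<^sup>2\<close>, where \<open>L\<close> is that of \<open>c\<close>,
  contradicting the lower bound \<open>L + \<parallel>w\<parallel>\<^sup>2\<close>.
\<close>

lemma weakly_converges_if_centres_in:
  fixes u :: "nat \<Rightarrow> 'a::{real_inner, complete_space}"
  assumes B: "\<And>k. norm (u k) \<le> B"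
    and conv: "\<And>p. p \<in> S \<Longrightarrow> convergent (\<lambda>k. (norm (u k - p))\<^sup>2)"
    and centres: "\<And>F c r. F \<noteq> bot \<Longrightarrow> F \<le> sequentially \<Longrightarrow> asymptotic_centre F u c r \<Longrightarrow> c \<in> S"
  shows "\<exists>c\<in>S. weakly_converges u c"
proof -
  obtain c r where c: "asymptotic_centre sequentially u c r"
    by (rule asymptotic_centre_exists[OF sequentially_bot B])
  have cS: "c \<in> S" using centres[OF _ _ c] by simp
  then obtain L where L: "(\<lambda>k. (norm (u k - c))\<^sup>2) \<longlonglongrightarrow> L"
    using conv unfolding convergent_def by blast
  have bound: "\<forall>\<^sub>F k in sequentially. (u k - c) \<bullet> w < e" if "0 < e" for w e
  proof (rule ccontr)
    assume not_ev: "\<not> (\<forall>\<^sub>F k in sequentially. (u k - c) \<bullet> w < e)"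
    define F where "F = inf sequentially (principal {k. e \<le> (u k - c) \<bullet> w})"
    have F: "F \<noteq> bot" "F \<le> sequentially"
      using not_ev unfolding F_def trivial_limit_def eventually_inf_principal
      by (auto simp: not_le elim: eventually_mono)
    obtain c' r' where c': "asymptotic_centre F u c' r'"
      by (rule asymptotic_centre_exists[OF F(1) B])
    obtain L' where L': "(\<lambda>k. (norm (u k - c'))\<^sup>2) \<longlonglongrightarrow> L'"
      using conv[OF centres[OF F c']] unfolding convergent_def by blast
    have LF: "((\<lambda>k. (norm (u k - c))\<^sup>2) \<longlongrightarrow> L) F" and LF': "((\<lambda>k. (norm (u k - c'))\<^sup>2) \<longlongrightarrow> L') F"
      using L L' F(2) tendsto_mono by blast+
    have "L + (norm (c' - c))\<^sup>2 \<le> L'"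
      by (rule asymptotic_centre_limit_le[OF c sequentially_bot L L'])
    moreover have "L' + (norm (c - c'))\<^sup>2 \<le> L"
      by (rule asymptotic_centre_limit_le[OF c' F(1) LF' LF])
    moreover have "0 \<le> (norm (c - c'))\<^sup>2" by simp
    ultimately have "(norm (c' - c))\<^sup>2 \<le> 0" by linarith
    then have "c' = c" by simp
    have "\<forall>\<^sub>F k in F. (norm (u k - c))\<^sup>2 < L + e"
      using \<open>0 < e\<close> by (intro order_tendstoD(2)[OF LF]) simp
    moreover have "\<forall>\<^sub>F k in F. e \<le> (u k - c) \<bullet> w"
      unfolding F_def eventually_inf_principal by simp
    ultimately have "\<forall>\<^sub>F k in F. (norm (u k - (c + w)))\<^sup>2 \<le> L + e - 2 * e + (norm w)\<^sup>2"
    proof eventually_elim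
      case (elim k)
      then show ?case using norm_diff_sq[of "u k - c" w] by (simp add: algebra_simps)
    qed
    from asymptotic_centre_limit_less[OF c'[unfolded \<open>c' = c\<close>] F(1) LF this]
    show False using \<open>0 < e\<close> by simp
  qed
  have "weakly_converges u c"
    unfolding weakly_converges_def
  proof (intro allI impI)
    fix f :: "'a \<Rightarrow> real" assume "bounded_linear f"
    then obtain w where w: "\<And>x. f x = w \<bullet> x" using riesz_representation by blast
    show "(\<lambda>k. f (u k)) \<longlonglongrightarrow> f c"
    proof (rule tendstoI)
      fix e :: real assume "0 < e"
      from bound[OF this, of w] bound[OF this, of "- w"]
      show "\<forall>\<^sub>F k in sequentially. dist (f (u k)) (f c) < e"
        by eventually_elim
           (auto simp: w dist_real_def abs_less_iff inner_diff_left inner_diff_right inner_commute)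
    qed
  qed
  with cS show ?thesis by blast
qed

section \<open>Krasnoselskii--Mann iteration\<close>

text \<open>
  The first decrease term comes from a contraction of \<open>Q\<close> towards \<open>p\<close> and drives strong convergence; the
  second comes from averaging alone and drives the residual to \<open>0\<close>.
\<close>

lemma relaxed_step_fejer:
  fixes Q :: "'a::real_inner \<Rightarrow> 'a"
  assumes "Q p = p"
  shows "(norm ((1 - a) *\<^sub>R x + a *\<^sub>R Q x - p))\<^sup>2
    = (norm (x - p))\<^sup>2 - a * ((norm (x - p))\<^sup>2 - (norm (Q x - Q p))\<^sup>2)
      - a * (1 - a) * (norm (x - Q x))\<^sup>2"
proof -
  have "(1 - a) *\<^sub>R x + a *\<^sub>R Q x - p = (1 - a) *\<^sub>R (x - p) + a *\<^sub>R (Q x - p)"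
    by (simp add: algebra_simps)
  then show ?thesis
    using norm_convex_combination_sq[of a "x - p" "Q x - p"] \<open>Q p = p\<close>
    by (simp add: algebra_simps)
qed

lemma decrease_sum_bounded:
  fixes s g :: "nat \<Rightarrow> real"
  assumes "\<And>k. s (Suc k) \<le> s k - g k" "\<And>k. 0 \<le> s k"
  shows "(\<Sum>k<n. g k) \<le> s 0"
proof -
  have "(\<Sum>k<n. g k) \<le> s 0 - s n"
  proof (induction n)
    case (Suc n)
    then show ?case using assms(1)[of n] by simp
  qed simp
  then show ?thesis using assms(2)[of n] by linarith
qed

locale mann_iteration =
  fixes Q :: "'a::{real_inner, complete_space} \<Rightarrow> 'a"
    and \<alpha> :: "nat \<Rightarrow> real" and u :: "nat \<Rightarrow> 'a"
  assumes nonexpansive: "norm (Q x - Q y) \<le> norm (x - y)"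
    and weight: "0 < \<alpha> k" "\<alpha> k < 1"
    and weights_diverge: "filterlim (\<lambda>n. \<Sum>k=1..n. \<alpha> k * (1 - \<alpha> k)) at_top sequentially"
    and step: "u (Suc k) = (1 - \<alpha> k) *\<^sub>R u k + \<alpha> k *\<^sub>R Q (u k)"
begin

lemma fejer:
  assumes "Q p = p"
  shows "(norm (u (Suc k) - p))\<^sup>2
    \<le> (norm (u k - p))\<^sup>2 - \<alpha> k * (1 - \<alpha> k) * (norm (u k - Q (u k)))\<^sup>2"
proof -
  have "(norm (Q (u k) - Q p))\<^sup>2 \<le> (norm (u k - p))\<^sup>2"
    using nonexpansive by (rule power_mono) simp
  then have "0 \<le> \<alpha> k * ((norm (u k - p))\<^sup>2 - (norm (Q (u k) - Q p))\<^sup>2)"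
    using weight[of k] by simp
  then show ?thesis
    unfolding step relaxed_step_fejer[of Q, OF assms] by linarith
qed

lemma distance_decreasing:
  assumes "Q p = p"
  shows "decseq (\<lambda>k. (norm (u k - p))\<^sup>2)"
proof (rule decseq_SucI)
  fix k
  have "0 \<le> \<alpha> k * (1 - \<alpha> k) * (norm (u k - Q (u k)))\<^sup>2"
    using weight[of k] by simp
  then show "(norm (u (Suc k) - p))\<^sup>2 \<le> (norm (u k - p))\<^sup>2"
    using fejer[OF assms, of k] by linarith
qed

lemma residual_decreasing: "decseq (\<lambda>k. norm (u k - Q (u k)))"
proof (rule decseq_SucI)
  fix k
  let ?d = "u k - Q (u k)"
  have "u (Suc k) - u k = - (\<alpha> k *\<^sub>R ?d)"
    unfolding step by (simp add: algebra_simps)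
  then have "norm (Q (u k) - Q (u (Suc k))) \<le> \<alpha> k * norm ?d"
    using nonexpansive[of "u (Suc k)" "u k"] weight[of k] by (simp add: norm_minus_commute)
  moreover have eq: "u (Suc k) - Q (u (Suc k)) = (1 - \<alpha> k) *\<^sub>R ?d + (Q (u k) - Q (u (Suc k)))"
    unfolding step by (simp add: algebra_simps)
  have "norm (u (Suc k) - Q (u (Suc k))) \<le> (1 - \<alpha> k) * norm ?d + norm (Q (u k) - Q (u (Suc k)))"
    unfolding eq by (rule order_trans[OF norm_triangle_ineq]) (use weight[of k] in simp)
  ultimately show "norm (u (Suc k) - Q (u (Suc k))) \<le> norm ?d"
    by (simp add: algebra_simps)
qed

text \<open>
  The residuals decrease, so the last one times the sum of the \<open>\<alpha> k * (1 - \<alpha> k)\<close> is at most the weighted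
  sum of the squared residuals, which the Fejer inequality bounds by \<open>\<parallel>u 0 - p\<parallel>\<^sup>2\<close>.
\<close>

lemma residual_tendsto_zero:
  assumes "Q p = p"
  shows "(\<lambda>k. norm (u k - Q (u k))) \<longlonglongrightarrow> 0"
proof -
  let ?d = "\<lambda>k. norm (u k - Q (u k))" and ?\<sigma> = "\<lambda>n. \<Sum>k=1..n. \<alpha> k * (1 - \<alpha> k)"
  have pos: "0 < \<alpha> k * (1 - \<alpha> k)" for k using weight[of k] by simp
  have bound: "(?d n)\<^sup>2 * ?\<sigma> n \<le> (norm (u 0 - p))\<^sup>2" for n
  proof -
    have "(?d n)\<^sup>2 * ?\<sigma> n = (\<Sum>k=1..n. \<alpha> k * (1 - \<alpha> k) * (?d n)\<^sup>2)"
      by (simp add: sum_distrib_left sum_distrib_right mult.commute)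
    also have "\<dots> \<le> (\<Sum>k=1..n. \<alpha> k * (1 - \<alpha> k) * (?d k)\<^sup>2)"
      using pos residual_decreasing
      by (intro sum_mono mult_left_mono power_mono) (auto simp: decseq_def less_imp_le)
    also have "\<dots> \<le> (\<Sum>k<Suc n. \<alpha> k * (1 - \<alpha> k) * (?d k)\<^sup>2)"
      using pos by (intro sum_mono2) (auto simp: less_imp_le)
    also have "\<dots> \<le> (norm (u 0 - p))\<^sup>2"
      by (rule decrease_sum_bounded[where s = "\<lambda>k. (norm (u k - p))\<^sup>2"]) (use fejer[OF assms] in auto)
    finally show ?thesis .
  qed
  have "(\<lambda>n. (?d n)\<^sup>2) \<longlonglongrightarrow> 0"
  proof (rule tendsto_sandwich[where f = "\<lambda>_. 0"])
    have "\<forall>\<^sub>F n in sequentially. 0 < ?\<sigma> n"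
      using weights_diverge by (simp add: filterlim_at_top_dense)
    then show "\<forall>\<^sub>F n in sequentially. (?d n)\<^sup>2 \<le> (norm (u 0 - p))\<^sup>2 / ?\<sigma> n"
      by eventually_elim (use bound in \<open>simp add: pos_le_divide_eq\<close>)
    show "(\<lambda>n. (norm (u 0 - p))\<^sup>2 / ?\<sigma> n) \<longlonglongrightarrow> 0"
      by (intro tendsto_divide_0[OF tendsto_const] filterlim_at_top_imp_at_infinity weights_diverge)
  qed auto
  then show ?thesis by (simp add: power_tendsto_0_iff)
qed

theorem weak_convergence:
  assumes p: "Q p = p"
  shows "\<exists>c. Q c = c \<and> weakly_converges u c"
proof -
  have near: "norm (u k - p) \<le> norm (u 0 - p)" for k
    using decseqD[OF distance_decreasing[OF p], of 0 k] by (simp add: power2_le_iff_abs_le)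
  have B: "norm (u k) \<le> norm (u 0 - p) + norm p" for k
    using norm_triangle_ineq[of "u k - p" p] near[of k] by simp
  have "\<exists>c\<in>{c. Q c = c}. weakly_converges u c"
  proof (rule weakly_converges_if_centres_in[OF B])
    fix q assume "q \<in> {c. Q c = c}"
    then have "decseq (\<lambda>k. (norm (u k - q))\<^sup>2)" using distance_decreasing by simp
    then show "convergent (\<lambda>k. (norm (u k - q))\<^sup>2)"
      by (rule decseq_convergent[of _ 0]) (auto simp: convergent_def)
  next
    fix F c r assume F: "F \<noteq> bot" "F \<le> sequentially" and c: "asymptotic_centre F u c r"
    have "norm (u k - c) \<le> norm (u 0 - p) + norm p + norm c" for k
      using norm_triangle_ineq4[of "u k" c] B[of k] by linarith
    moreover have "((\<lambda>k. norm (u k - Q (u k))) \<longlongrightarrow> 0) F"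
      using tendsto_mono[OF F(2) residual_tendsto_zero[OF p]] .
    ultimately have "Q c = c"
      using asymptotic_centre_fixed_point[OF c nonexpansive] by blast
    then show "c \<in> {c. Q c = c}" by simp
  qed
  then show ?thesis by blast
qed

text \<open>
  Here \<open>g\<close> measures a defect by which \<open>Q\<close> contracts strictly towards \<open>p\<close>; each step lowers the squared
  distance to \<open>p\<close> by at least \<open>a * \<delta> * \<parallel>g (u k)\<parallel>\<^sup>2\<close>, so these quantities are summable.
\<close>

lemma contracted_quantity_tendsto_zero:
  assumes p: "Q p = p" and "0 < \<delta>"
    and strict: "\<And>x. (norm (Q x - Q p))\<^sup>2 \<le> (norm (x - p))\<^sup>2 - \<delta> * (norm (g x))\<^sup>2"
    and \<alpha>_ge: "0 < a" "\<And>k. a \<le> \<alpha> k"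
  shows "(\<lambda>k. norm (g (u k))) \<longlonglongrightarrow> 0"
proof -
  have dec: "(norm (u (Suc k) - p))\<^sup>2 \<le> (norm (u k - p))\<^sup>2 - a * \<delta> * (norm (g (u k)))\<^sup>2" for k
  proof -
    have "a * (\<delta> * (norm (g (u k)))\<^sup>2) \<le> \<alpha> k * ((norm (u k - p))\<^sup>2 - (norm (Q (u k) - Q p))\<^sup>2)"
      using strict[of "u k"] \<alpha>_ge \<open>0 < \<delta>\<close> by (intro mult_mono) (auto intro: less_imp_le[OF weight(1)])
    moreover have "0 \<le> \<alpha> k * (1 - \<alpha> k) * (norm (u k - Q (u k)))\<^sup>2"
      using weight[of k] by simp
    ultimately show ?thesis
      unfolding step relaxed_step_fejer[of Q, OF p] by (simp add: mult.assoc)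
  qed
  have "(\<Sum>k\<le>n. a * \<delta> * (norm (g (u k)))\<^sup>2) \<le> (norm (u 0 - p))\<^sup>2" for n
    unfolding lessThan_Suc_atMost[symmetric]
    by (rule decrease_sum_bounded[of "\<lambda>k. (norm (u k - p))\<^sup>2", OF dec]) simp
  then have "summable (\<lambda>k. a * \<delta> * (norm (g (u k)))\<^sup>2)"
    using \<open>0 < \<delta>\<close> \<open>0 < a\<close> by (intro bounded_imp_summable) auto
  then have "(\<lambda>k. a * \<delta> * (norm (g (u k)))\<^sup>2) \<longlonglongrightarrow> 0" by (rule summable_LIMSEQ_zero)
  then have "(\<lambda>k. (norm (g (u k)))\<^sup>2) \<longlonglongrightarrow> 0"
    using \<open>0 < \<delta>\<close> \<open>0 < a\<close> by (simp add: tendsto_mult_left_iff)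
  then show ?thesis by (simp add: power_tendsto_0_iff)
qed

end

section \<open>The fixed-point map of the composite resolvent\<close>

text \<open>
  For \<open>d = v - w\<close>, the adjoint turns the cross term \<open>C C\<^sup>T d \<bullet> d\<close> into \<open>\<parallel>C\<^sup>T d\<parallel>\<^sup>2\<close>, and the quadratic term
  is at most \<open>s\<^sup>2 \<parallel>C\<parallel>\<^sup>2 \<parallel>C\<^sup>T d\<parallel>\<^sup>2\<close>. Measuring the gain by \<open>C\<^sup>T d\<close> instead of discarding it is what later
  yields strong convergence of \<open>C\<^sup>T (u k)\<close>.
\<close>

lemma fixed_point_map_contraction:
  fixes C :: "'a::{real_inner, complete_space} \<Rightarrow> 'b::{real_inner, complete_space}"
  assumes C: "bounded_linear C" and M: "maximal_monotone M" and "0 < m"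
    and s: "s = l * m"
  shows "(norm (fixed_point_map C M l m y v - fixed_point_map C M l m y w))\<^sup>2
    \<le> (norm (v - w))\<^sup>2 - s * (2 - s * (onorm C)\<^sup>2) * (norm (adjoint C (v - w)))\<^sup>2"
proof -
  interpret A: linear "adjoint C" by (rule linear_adjoint[OF C])
  let ?z = "\<lambda>v. C y + (v - s *\<^sub>R C (adjoint C v))"
  let ?d = "v - w"
  let ?g = "adjoint C ?d"
  have "(norm (fixed_point_map C M l m y v - fixed_point_map C M l m y w))\<^sup>2
      \<le> (norm (?z v - ?z w))\<^sup>2"
    using resolvent_complement_nonexpansive[OF M, of "1 / m" "?z v" "?z w"] \<open>0 < m\<close>
    unfolding fixed_point_map_def Let_def s by (intro power_mono) auto
  also have "?z v - ?z w = ?d - s *\<^sub>R C ?g"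
    by (simp add: A.diff bounded_linear.linear[OF C] linear_diff scaleR_diff_right)
  also have "(norm \<dots>)\<^sup>2 = (norm ?d)\<^sup>2 - 2 * s * (C ?g \<bullet> ?d) + s\<^sup>2 * (norm (C ?g))\<^sup>2"
    by (simp add: norm_diff_sq power_mult_distrib inner_commute)
  also have "C ?g \<bullet> ?d = (norm ?g)\<^sup>2"
    by (simp add: adjoint_inner[OF C] power2_norm_eq_inner)
  also have "s\<^sup>2 * (norm (C ?g))\<^sup>2 \<le> s\<^sup>2 * (onorm C * norm ?g)\<^sup>2"
    by (intro mult_left_mono power_mono onorm[OF C]) auto
  finally show ?thesis by (simp add: power_mult_distrib power2_eq_square algebra_simps)
qed

lemma monotone_composite_operator:
  fixes C :: "'a::{real_inner, complete_space} \<Rightarrow> 'b::real_inner"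
  assumes C: "bounded_linear C" and M: "monotone_operator M"
  shows "monotone_operator (composite_operator C M)"
  unfolding monotone_operator_def composite_operator_def
proof clarify
  fix x x' w w' assume "w \<in> M (C x)" "w' \<in> M (C x')"
  then have "0 \<le> (C x - C x') \<bullet> (w - w')"
    using M unfolding monotone_operator_def by blast
  also have "\<dots> = C (x - x') \<bullet> (w - w')"
    using C by (simp add: bounded_linear.linear linear_diff)
  also have "\<dots> = (x - x') \<bullet> (adjoint C w - adjoint C w')"
    using C by (simp add: adjoint_inner linear_diff[OF linear_adjoint])
  finally show "0 \<le> (x - x') \<bullet> (adjoint C w - adjoint C w')" .
qed

text \<open>
  The argument of \<open>I - J\<close> in the definition of the map is \<open>C x + v\<close> with \<open>x = y - l m C\<^sup>T v\<close>. So \<open>v\<close> is fixed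
  iff \<open>J (C x + v) = C x\<close>, that is, \<open>v \<in> M (C x) / m\<close>.
\<close>

lemma fixed_point_map_eq_self_iff:
  fixes C :: "'a::{real_inner, complete_space} \<Rightarrow> 'b::{real_inner, complete_space}"
  assumes C: "bounded_linear C" and M: "maximal_monotone M" and "0 < m"
  shows "fixed_point_map C M l m y v = v
    \<longleftrightarrow> m *\<^sub>R v \<in> M (C (y - (l * m) *\<^sub>R adjoint C v))"
proof -
  let ?x = "y - (l * m) *\<^sub>R adjoint C v"
  let ?J = "resolvent_point (scale_operator (1 / m) M)"
  have z: "C y + (v - (l * m) *\<^sub>R C (adjoint C v)) = C ?x + v"
    using C by (simp add: bounded_linear.linear linear_diff linear_cmul)
  have "fixed_point_map C M l m y v = v \<longleftrightarrow> ?J (C ?x + v) = C ?x"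
    unfolding fixed_point_map_def Let_def z by (auto simp: algebra_simps)
  also have "\<dots> \<longleftrightarrow> C ?x \<in> resolvent (scale_operator (1 / m) M) (C ?x + v)"
    using resolvent_point_mem[OF M, of "1 / m" "C ?x + v"] resolvent_point_eq[of M "1 / m"] M \<open>0 < m\<close>
    unfolding maximal_monotone_def by (metis less_imp_le zero_less_divide_1_iff)
  also have "\<dots> \<longleftrightarrow> m *\<^sub>R v \<in> M (C ?x)"
    unfolding resolvent_scale_operator_iff using \<open>0 < m\<close> by force
  finally show ?thesis .
qed

lemma fixed_point_imp_resolvent:
  fixes C :: "'a::{real_inner, complete_space} \<Rightarrow> 'b::{real_inner, complete_space}"
  assumes C: "bounded_linear C" and M: "maximal_monotone M" and "0 < m"
    and "fixed_point_map C M l m y v = v"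
  shows "y - (l * m) *\<^sub>R adjoint C v \<in> resolvent (scale_operator l (composite_operator C M)) y"
  unfolding resolvent_scale_operator_iff composite_operator_def
  using assms(4) unfolding fixed_point_map_eq_self_iff[OF assms(1-3)]
  by (auto intro!: bexI[of _ "m *\<^sub>R v"] simp: linear_cmul[OF linear_adjoint[OF C]])

lemma resolvent_imp_fixed_point:
  fixes C :: "'a::{real_inner, complete_space} \<Rightarrow> 'b::{real_inner, complete_space}"
  assumes C: "bounded_linear C" and M: "maximal_monotone M" and "0 < m"
    and "resolvent (scale_operator l (composite_operator C M)) y \<noteq> {}"
  shows "\<exists>v. fixed_point_map C M l m y v = v"
proof -
  obtain x w where w: "w \<in> M (C x)" "y = x + l *\<^sub>R adjoint C w"
    using assms(4) unfolding ex_in_conv[symmetric] resolvent_scale_operator_iff composite_operator_def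
    by blast
  have "(l * m) *\<^sub>R adjoint C ((1 / m) *\<^sub>R w) = l *\<^sub>R adjoint C w"
    using \<open>0 < m\<close> by (simp add: linear_cmul[OF linear_adjoint[OF C]])
  then have "fixed_point_map C M l m y ((1 / m) *\<^sub>R w) = (1 / m) *\<^sub>R w"
    unfolding fixed_point_map_eq_self_iff[OF assms(1-3)] using w \<open>0 < m\<close> by simp
  then show ?thesis by blast
qed

theorem corollary8:
  fixes C :: "'a::{real_inner, complete_space} \<Rightarrow> 'b::{real_inner, complete_space}"
    and M :: "'b \<Rightarrow> 'b set"
    and l m :: real and y :: 'a
    and \<alpha> :: "nat \<Rightarrow> real" and u :: "nat \<Rightarrow> 'b"
  assumes "bounded_linear C"
    and "maximal_monotone M"
    and "l > 0"
    and "resolvent (scale_operator l (composite_operator C M)) y \<noteq> {}"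
    and "m > 0"
    and "0 < l * m"
    and "onorm C = 0 \<or> l * m < 2 / (onorm C)\<^sup>2"
    and "\<And>k. 0 < \<alpha> k \<and> \<alpha> k < 1"
    and "filterlim (\<lambda>n. \<Sum>k=1..n. \<alpha> k * (1 - \<alpha> k)) at_top sequentially"
    and "\<And>k. u (Suc k) = (1 - \<alpha> k) *\<^sub>R u k + \<alpha> k *\<^sub>R fixed_point_map C M l m y (u k)"
  shows "(\<exists>u'. weakly_converges u u' \<and> fixed_point_map C M l m y u' = u' \<and>
            resolvent (scale_operator l (composite_operator C M)) y
              = {y - (l * m) *\<^sub>R adjoint C u'}) \<and>
         ((INF k. \<alpha> k) > 0 \<longrightarrow>
            (\<lambda>k. y - (l * m) *\<^sub>R adjoint C (u k))
              \<longlonglongrightarrow> resolvent_point (scale_operator l (composite_operator C M)) y)"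
proof -
  let ?Q = "fixed_point_map C M l m y"
  let ?R = "scale_operator l (composite_operator C M)"
  define \<delta> where "\<delta> = l * m * (2 - l * m * (onorm C)\<^sup>2)"
  have "l * m * (onorm C)\<^sup>2 < 2"
    using assms(7)
  proof
    assume less: "l * m < 2 / (onorm C)\<^sup>2"
    show ?thesis
    proof (cases "onorm C = 0")
      case False
      then show ?thesis using less by (simp add: pos_less_divide_eq)
    qed simp
  qed simp
  then have \<delta>: "0 < \<delta>" unfolding \<delta>_def using assms(6) by simp
  have contraction: "(norm (?Q v - ?Q w))\<^sup>2 \<le> (norm (v - w))\<^sup>2 - \<delta> * (norm (adjoint C (v - w)))\<^sup>2"
    for v w
    unfolding \<delta>_def by (rule fixed_point_map_contraction[OF assms(1,2,5) refl])
  interpret mann_iteration ?Q \<alpha> u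
  proof
    fix v w
    have "(norm (?Q v - ?Q w))\<^sup>2 \<le> (norm (v - w))\<^sup>2"
      by (rule order_trans[OF contraction]) (use \<delta> in simp)
    then show "norm (?Q v - ?Q w) \<le> norm (v - w)" by (rule power2_le_imp_le) simp
  qed (use assms(8-10) in auto)
  obtain p where "?Q p = p"
    using resolvent_imp_fixed_point[OF assms(1,2,5,4)] by blast
  then obtain c where c: "?Q c = c" "weakly_converges u c"
    using weak_convergence by blast
  have c_mem: "y - (l * m) *\<^sub>R adjoint C c \<in> resolvent ?R y"
    by (rule fixed_point_imp_resolvent[OF assms(1,2,5) c(1)])
  have mono: "monotone_operator (composite_operator C M)"
    using assms(1,2) monotone_composite_operator unfolding maximal_monotone_def by blast
  have single: "resolvent ?R y = {y - (l * m) *\<^sub>R adjoint C c}"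
    by (rule resolvent_eq_singleton[OF mono _ c_mem]) (use assms(3) in simp)
  have "(\<lambda>k. y - (l * m) *\<^sub>R adjoint C (u k)) \<longlonglongrightarrow> resolvent_point ?R y" if inf: "(INF k. \<alpha> k) > 0"
  proof -
    have "(INF k. \<alpha> k) \<le> \<alpha> k" for k
      using assms(8) by (intro cINF_lower) (auto intro!: bdd_belowI[of _ 0] less_imp_le)
    from contracted_quantity_tendsto_zero[of c \<delta> "\<lambda>v. adjoint C (v - c)", OF c(1) \<delta> contraction inf this]
    have "(\<lambda>k. adjoint C (u k) - adjoint C c) \<longlonglongrightarrow> 0"
      by (simp add: linear_diff[OF linear_adjoint[OF assms(1)]] tendsto_norm_zero_iff)
    then have "(\<lambda>k. adjoint C (u k)) \<longlonglongrightarrow> adjoint C c"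
      by (rule LIM_zero_cancel)
    then show ?thesis
      unfolding resolvent_point_def single by (auto intro!: tendsto_intros)
  qed
  with c single show ?thesis by blast
qed

end
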